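(* Let $a>0$, $g=e^{-2a}/(2a)$, and $$\mathbb{P}=\frac12\begin{pmatrix}1&1/a\\ a&1\end{pmatrix},\quad R=\frac12\begin{pmatrix}1&1/a\\ -a&-1\end{pmatrix},\quad X=\begin{pmatrix}1&0\\0&-1\end{pmatrix}.$$ For $\sigma_0,\sigma_1,\sigma_2\in\mathbb{C}\setminus\{0,-1\}$ let $J_3=D^{-1}N$ with $$D=\operatorname{diag}\big((1+\sigma_1)\mathrm{I}-\mathbb{P},\ (1+\sigma_0)\mathrm{I}-\mathbb{P},\ (1+\sigma_0)\mathrm{I}-\mathbb{P},\ (1+\sigma_2)\mathrm{I}-\mathbb{P}\big),\quad N=\begin{pmatrix}0&\sigma_1X&0&0\\ \sigma_0X&0&2agR&0\\ 0&2agR&0&\sigma_0X\\ 0&0&\sigma_2X&0\end{pmatrix}.$$ Then, as $\sigma_0,\sigma_1,\sigma_2\to0$, $J_3$ converges to $$J_3^0=\begin{pmatrix}0&\mathbb{P}X&0&0\\ \mathbb{P}X&0&2agR&0\\ 0&2agR&0&\mathbb{P}X\\ 0&0&\mathbb{P}X&0\end{pmatrix},$$ and $(J_3^0)^4=0$. Consequently, for all $\alpha_{\pm1},\beta_{\pm1}$ and every initial guess, the iteration $U^{n+1}=J_3^0U^n+\tilde F$ with $$\tilde F=\begin{pmatrix}\mathbb{P}(-\alpha_{-1},\beta_{-1})^T\\ \mathbb{P}(\alpha_{-1},\beta_{-1})^T\\ \mathbb{P}(\alpha_{1},\beta_{1})^T\\ \mathbb{P}(-\alpha_{1},\beta_{1})^T\end{pmatrix}$$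 converges in at most $4$ iterations.
   Context: $\mathrm{I}$ is the $2\times2$ identity matrix; $U=(U_1,U_{01},U_{02},U_2)\in(\mathbb{C}^2)^4$. "Converges in at most $4$ iterations" means that $U^n$ equals the fixed point of the iteration for all $n\ge4$. The iteration is the limit, for vanishing relaxation parameters, of the block Jacobi iteration for the multitrace formulation of $-u''+a^2u=0$ with the three subdomains $(-\infty,-1)$, $(-1,1)$, $(1,\infty)$, with Dirichlet jumps $\alpha_{\pm1}$ and Neumann jumps $\beta_{\pm1}$ at $x=\pm1$. *)

theory Defs
  imports "HOL-Analysis.Analysis"
begin

text \<open>Elements of \<open>(complex^2)^4\<close>, and matrices made of 4 by 4 blocks of size 2 by 2, are indexed by pairs
  (block number, position inside the block). In this way the library's matrix product,
  matrix inverse and topology apply to the assembled 8 by 8 matrices.\<close>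

definition block_vec :: "complex^2^4 \<Rightarrow> complex^(4 \<times> 2)" where
  "block_vec v = (\<chi> p. v $ fst p $ snd p)"

definition block_mat :: "complex^2^2^4^4 \<Rightarrow> complex^(4 \<times> 2)^(4 \<times> 2)" where
  "block_mat B = (\<chi> p q. B $ fst p $ fst q $ snd p $ snd q)"

definition cscale :: "complex \<Rightarrow> complex^2^2 \<Rightarrow> complex^2^2" where
  "cscale c A = (\<chi> i j. c * A $ i $ j)"

definition Pmat :: "real \<Rightarrow> complex^2^2" where
  "Pmat a = cscale (1/2)
     (vector [vector [1, 1 / of_real a],
              vector [of_real a, 1]])"

definition Rmat :: "real \<Rightarrow> complex^2^2" where
  "Rmat a = cscale (1/2)
     (vector [vector [1, 1 / of_real a],
              vector [- of_real a, - 1]])"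

definition Xmat :: "complex^2^2" where
  "Xmat = vector [vector [1, 0], vector [0, - 1]]"

definition gcoef :: "real \<Rightarrow> real" where
  "gcoef a = exp (- 2 * a) / (2 * a)"

definition twoagR :: "real \<Rightarrow> complex^2^2" where
  "twoagR a = cscale (of_real (2 * a * gcoef a)) (Rmat a)"

definition Dmat :: "real \<Rightarrow> complex \<Rightarrow> complex \<Rightarrow> complex \<Rightarrow> complex^(4 \<times> 2)^(4 \<times> 2)" where
  "Dmat a \<sigma>0 \<sigma>1 \<sigma>2 = block_mat (vector
     [vector [mat (1 + \<sigma>1) - Pmat a, 0, 0, 0],
      vector [0, mat (1 + \<sigma>0) - Pmat a, 0, 0],
      vector [0, 0, mat (1 + \<sigma>0) - Pmat a, 0],
      vector [0, 0, 0, mat (1 + \<sigma>2) - Pmat a]])"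

definition Nmat :: "real \<Rightarrow> complex \<Rightarrow> complex \<Rightarrow> complex \<Rightarrow> complex^(4 \<times> 2)^(4 \<times> 2)" where
  "Nmat a \<sigma>0 \<sigma>1 \<sigma>2 = block_mat (vector
     [vector [0, cscale \<sigma>1 Xmat, 0, 0],
      vector [cscale \<sigma>0 Xmat, 0, twoagR a, 0],
      vector [0, twoagR a, 0, cscale \<sigma>0 Xmat],
      vector [0, 0, cscale \<sigma>2 Xmat, 0]])"

definition J3 :: "real \<Rightarrow> complex \<Rightarrow> complex \<Rightarrow> complex \<Rightarrow> complex^(4 \<times> 2)^(4 \<times> 2)" where
  "J3 a \<sigma>0 \<sigma>1 \<sigma>2 = matrix_inv (Dmat a \<sigma>0 \<sigma>1 \<sigma>2) ** Nmat a \<sigma>0 \<sigma>1 \<sigma>2"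

definition J30 :: "real \<Rightarrow> complex^(4 \<times> 2)^(4 \<times> 2)" where
  "J30 a = block_mat (vector
     [vector [0, Pmat a ** Xmat, 0, 0],
      vector [Pmat a ** Xmat, 0, twoagR a, 0],
      vector [0, twoagR a, 0, Pmat a ** Xmat],
      vector [0, 0, Pmat a ** Xmat, 0]])"

text \<open>The arguments are the Dirichlet and Neumann jumps at -1, followed by those at 1.\<close>

definition Ftilde :: "real \<Rightarrow> complex \<Rightarrow> complex \<Rightarrow> complex \<Rightarrow> complex \<Rightarrow> complex^(4 \<times> 2)" where
  "Ftilde a \<alpha>m \<beta>m \<alpha>p \<beta>p = block_vec (vector
     [Pmat a *v vector [- \<alpha>m, \<beta>m],
      Pmat a *v vector [\<alpha>m, \<beta>m],
      Pmat a *v vector [\<alpha>p, \<beta>p],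
      Pmat a *v vector [- \<alpha>p, \<beta>p]])"

lemma vector_4:
  "(vector [w, x, y, z] :: 'b::zero^4) $ 1 = w"
  "(vector [w, x, y, z] :: 'b::zero^4) $ 2 = x"
  "(vector [w, x, y, z] :: 'b::zero^4) $ 3 = y"
  "(vector [w, x, y, z] :: 'b::zero^4) $ 4 = z"
  unfolding vector_def by simp_all

lemma sum_block_index: "(\<Sum>p\<in>(UNIV :: (4 \<times> 2) set). f p) = (\<Sum>i\<in>UNIV. \<Sum>j\<in>UNIV. f (i, j))"
  by (simp add: sum.cartesian_product UNIV_Times_UNIV[symmetric] del: UNIV_Times_UNIV)

lemma block_mat_mult:
  "block_mat A ** block_mat B = block_mat (\<chi> i j. \<Sum>k\<in>UNIV. A $ i $ k ** B $ k $ j)"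
  by (simp add: vec_eq_iff block_mat_def matrix_matrix_mult_def sum_block_index)

lemma mat_1_block: "mat 1 = block_mat (mat (mat 1))"
  by (auto simp: vec_eq_iff block_mat_def mat_def)

lemma block_invertible:
  fixes s :: complex
  assumes "a > 0" "s \<noteq> 0" "s \<noteq> - 1"
  obtains E where "(mat (1 + s) - Pmat a) ** E = mat 1"
proof
  define t where "t = 1 + s"
  define c where "c = complex_of_real a"
  have nz: "t \<noteq> 0" "s \<noteq> 0" "c \<noteq> 0"
    using assms by (auto simp: t_def c_def add_eq_0_iff)
  have st: "s = t - 1"
    by (simp add: t_def)
  show "(mat (1 + s) - Pmat a) ** (cscale (1 / t) (mat 1 - Pmat a) + cscale (1 / s) (Pmat a)) = mat 1"
    unfolding t_def[symmetric]
    using nz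
    by (simp add: vec_eq_iff forall_2 matrix_matrix_mult_def sum_2 mat_def cscale_def Pmat_def
        c_def[symmetric])
       (simp add: divide_simps, simp add: st algebra_simps)
qed

text \<open>\<open>matrix_inv\<close> is unspecified on singular matrices; the next fact is what makes
  \<open>J3\<close> meaningful for all admissible relaxation parameters.\<close>

lemma Dmat_invertible:
  assumes "a > 0" "\<sigma>0 \<notin> {0, - 1}" "\<sigma>1 \<notin> {0, - 1}" "\<sigma>2 \<notin> {0, - 1}"
  shows "invertible (Dmat a \<sigma>0 \<sigma>1 \<sigma>2)"
proof -
  obtain E0 where E0: "(mat (1 + \<sigma>0) - Pmat a) ** E0 = mat 1"
    using block_invertible[of a \<sigma>0] assms by blast
  obtain E1 where E1: "(mat (1 + \<sigma>1) - Pmat a) ** E1 = mat 1"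
    using block_invertible[of a \<sigma>1] assms by blast
  obtain E2 where E2: "(mat (1 + \<sigma>2) - Pmat a) ** E2 = mat 1"
    using block_invertible[of a \<sigma>2] assms by blast
  let ?E = "block_mat (vector [vector [E1, 0, 0, 0], vector [0, E0, 0, 0],
                               vector [0, 0, E0, 0], vector [0, 0, 0, E2]])"
  have "Dmat a \<sigma>0 \<sigma>1 \<sigma>2 ** ?E = mat 1"
    unfolding Dmat_def block_mat_mult mat_1_block
    by (rule arg_cong[where f = block_mat]; subst vec_eq_iff; subst vec_eq_iff)
       (simp add: forall_4 sum_4 vector_4 E0 E1 E2, simp add: mat_def)
  then show ?thesis
    using invertible_right_inverse by blast
qed

end

theory Submission
  imports Defs
begin

text \<open>The blocks satisfy \<open>\<P> R = 0\<close>, \<open>(\<P> X)\<^sup>2 = 0\<close>, \<open>R\<^sup>2 = 0\<close>. Since \<open>\<P>\<close> is a projector, \<open>((1 + \<sigma>) I - \<P>)\<^sup>-\<^sup>1 = (I - \<P>) / (1 + \<sigma>) + \<P> / \<sigma>\<close>,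
  and the singular part meets only \<open>\<sigma> X\<close> and \<open>R\<close>: it turns the former into \<open>\<P> X\<close> and
  annihilates the latter. Squaring \<open>J\<^sub>3\<^sup>0\<close> leaves only the products of one \<open>\<P> X\<close> with one \<open>R\<close>,
  and squaring again produces a factor \<open>(\<P> X)\<^sup>2\<close> or \<open>R\<^sup>2\<close> in every block. An affine
  iteration with nilpotent linear part stabilises because the difference of two of its
  orbits is an orbit of the linear part.\<close>

lemma affine_orbits_diff:
  fixes T :: "'a::ab_group_add \<Rightarrow> 'a"
  assumes T: "\<And>x y. T (x - y) = T x - T y"
    and u: "\<And>n. u (Suc n) = T (u n) + f" and v: "\<And>n. v (Suc n) = T (v n) + f"
  shows "u n - v n = (T ^^ n) (u 0 - v 0)"
  by (induction n) (simp_all add: u v flip: T)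

text \<open>Any two orbits agree at index \<open>m\<close>, because \<open>T ^^ m\<close> kills
  their difference. Each claim comes from a suitable pair of orbits, and the fixed point itself is
  found inside an orbit.\<close>

lemma affine_iteration_nilpotent:
  fixes T :: "'a::ab_group_add \<Rightarrow> 'a"
  assumes T: "\<And>x y. T (x - y) = T x - T y" and nil: "\<And>x. (T ^^ m) x = 0"
  shows "\<exists>V. (\<forall>W. W = T W + f \<longleftrightarrow> W = V) \<and>
           (\<forall>U. (\<forall>n. U (Suc n) = T (U n) + f) \<longrightarrow> (\<forall>n\<ge>m. U n = V))"
proof -
  have agree: "u m = v m"
    if "\<And>n. u (Suc n) = T (u n) + f" "\<And>n. v (Suc n) = T (v n) + f" for u v :: "nat \<Rightarrow> 'a"
    using affine_orbits_diff[of T u f v m, OF T that] nil by simp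
  define u where "u n = ((\<lambda>x. T x + f) ^^ n) 0" for n
  have u: "u (Suc n) = T (u n) + f" for n
    by (simp add: u_def)
  \<comment> \<open>The shift of an orbit is again an orbit, so
    \<open>u m = u (Suc m)\<close>.\<close>
  have fixed: "u m = T (u m) + f"
    using agree[of u "\<lambda>n. u (Suc n)"] u by simp
  \<comment> \<open>A fixed point is a constant orbit.\<close>
  have unique: "W = u m" if "W = T W + f" for W
    using agree[of "\<lambda>_. W" u] that u by simp
  have "U n = u m" if U: "\<forall>n. U (Suc n) = T (U n) + f" and "n \<ge> m" for U n
    \<comment> \<open>Shifting \<open>U\<close> by \<open>n - m\<close> brings its term of index
      \<open>n\<close> to index \<open>m\<close>.\<close>
    using agree[of "\<lambda>k. U (k + (n - m))" u] U u \<open>n \<ge> m\<close> by simp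
  with fixed unique show ?thesis
    by blast
qed

lemma tendsto_block_mat:
  assumes "\<And>i j. ((\<lambda>x. B x $ i $ j) \<longlongrightarrow> C $ i $ j) F"
  shows "((\<lambda>x. block_mat (B x)) \<longlongrightarrow> block_mat C) F"
  unfolding block_mat_def by (intro vec_tendstoI) (auto intro!: tendsto_vec_nth assms)

lemma tendsto_cscale:
  assumes "(f \<longlongrightarrow> c) F"
  shows "((\<lambda>x. cscale (f x) A) \<longlongrightarrow> cscale c A) F"
  unfolding cscale_def by (intro vec_tendstoI) (auto intro!: tendsto_intros assms)

text \<open>For \<open>a > 0\<close> and \<open>s\<close> outside \<open>{0, - 1}\<close> this is
  the inverse of \<open>mat (1 + s) - Pmat a\<close> times \<open>cscale s Xmat\<close>. The pole at
  \<open>s = 0\<close> is cancelled, leaving the value \<open>Pmat a ** Xmat\<close> there.\<close>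

definition Kmat :: "real \<Rightarrow> complex \<Rightarrow> complex^2^2" where
  "Kmat a s = cscale (s / (1 + s)) ((mat 1 - Pmat a) ** Xmat) + Pmat a ** Xmat"

text \<open>The same inverse times \<open>twoagR a\<close>: the singular term
  \<open>Pmat a / s\<close> drops out since \<open>Pmat a ** Rmat a = 0\<close>.\<close>

definition Lmat :: "real \<Rightarrow> complex \<Rightarrow> complex^2^2" where
  "Lmat a s = cscale (1 / (1 + s)) (twoagR a)"

text \<open>The left factor acts as \<open>1 + s\<close> on the range of the projector
  \<open>mat 1 - Pmat a\<close> and as \<open>s\<close> on that of \<open>Pmat a\<close>, so both
  terms of \<open>Kmat\<close> end up with the coefficient \<open>s\<close>.\<close>

lemma block_times_Kmat:
  assumes "a > 0" "s \<noteq> - 1"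
  shows "(mat (1 + s) - Pmat a) ** Kmat a s = cscale s Xmat"
proof -
  define t where "t = 1 + s"
  define c where "c = complex_of_real a"
  have nz: "t \<noteq> 0" "c \<noteq> 0"
    using assms by (auto simp: t_def c_def add_eq_0_iff)
  have st: "s = t - 1"
    by (simp add: t_def)
  show ?thesis
    unfolding Kmat_def t_def[symmetric]
    using nz
    by (simp add: vec_eq_iff forall_2 matrix_matrix_mult_def sum_2 mat_def cscale_def Pmat_def
        Xmat_def c_def[symmetric])
       (simp add: divide_simps, simp add: st algebra_simps)
qed

lemma block_times_Lmat:
  assumes "a > 0" "s \<noteq> - 1"
  shows "(mat (1 + s) - Pmat a) ** Lmat a s = twoagR a"
proof -
  define t where "t = 1 + s"
  define c where "c = complex_of_real a"
  \<comment> \<open>Hiding the exponential in \<open>d\<close> leaves a rational identity in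
    \<open>t\<close>, \<open>c\<close> and \<open>d\<close>.\<close>
  define d where "d = complex_of_real (2 * a * gcoef a)"
  have nz: "t \<noteq> 0" "c \<noteq> 0"
    using assms by (auto simp: t_def c_def add_eq_0_iff)
  show ?thesis
    unfolding Lmat_def twoagR_def t_def[symmetric] d_def[symmetric]
    using nz
    by (simp add: vec_eq_iff forall_2 matrix_matrix_mult_def sum_2 mat_def cscale_def Pmat_def
        Rmat_def c_def[symmetric])
       (simp add: divide_simps, simp add: algebra_simps)
qed

text \<open>Conjugation by \<open>Xmat\<close> turns \<open>Pmat a\<close> into the complementary
  projector \<open>mat 1 - Pmat a\<close>, and the product of the two is 0.\<close>

lemma PX_square:
  assumes "a > 0"
  shows "(Pmat a ** Xmat) ** (Pmat a ** Xmat) = 0"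
  using assms
  by (simp add: vec_eq_iff forall_2 matrix_matrix_mult_def sum_2 cscale_def Pmat_def Xmat_def)

text \<open>Here \<open>Rmat a = Xmat ** Pmat a\<close>, so the square vanishes for the same
  reason.\<close>

lemma twoagR_square:
  assumes "a > 0"
  shows "twoagR a ** twoagR a = 0"
proof -
  define d where "d = complex_of_real (2 * a * gcoef a)"
  show ?thesis
    unfolding twoagR_def d_def[symmetric]
    using assms
    by (simp add: vec_eq_iff forall_2 matrix_matrix_mult_def sum_2 cscale_def Rmat_def)
qed

text \<open>The right-hand side solves \<open>?D ** J = Nmat a \<sigma>0 \<sigma>1 \<sigma>2\<close>
  block by block, and invertibility of \<open>?D\<close> makes that solution unique.\<close>

lemma J3_eq:
  assumes "a > 0" "\<sigma>0 \<notin> {0, - 1}" "\<sigma>1 \<notin> {0, - 1}" "\<sigma>2 \<notin> {0, - 1}"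
  shows "J3 a \<sigma>0 \<sigma>1 \<sigma>2 = block_mat (vector
     [vector [0, Kmat a \<sigma>1, 0, 0],
      vector [Kmat a \<sigma>0, 0, Lmat a \<sigma>0, 0],
      vector [0, Lmat a \<sigma>0, 0, Kmat a \<sigma>0],
      vector [0, 0, Kmat a \<sigma>2, 0]])" (is "_ = ?J")
proof -
  let ?D = "Dmat a \<sigma>0 \<sigma>1 \<sigma>2"
  have "?D ** ?J = Nmat a \<sigma>0 \<sigma>1 \<sigma>2"
    unfolding Dmat_def Nmat_def block_mat_mult
    by (rule arg_cong[where f = block_mat]; subst vec_eq_iff; subst vec_eq_iff)
       (use assms in \<open>simp add: forall_4 sum_4 vector_4 block_times_Kmat block_times_Lmat\<close>)
  then have "J3 a \<sigma>0 \<sigma>1 \<sigma>2 = (matrix_inv ?D ** ?D) ** ?J"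
    unfolding J3_def by (simp flip: matrix_mul_assoc)
  then show ?thesis
    \<comment> \<open>\<open>matrix_inv\<close> is a choice; invertibility of \<open>?D\<close>
      ensures that a two-sided inverse is chosen.\<close>
    using someI_ex[OF Dmat_invertible[OF assms, unfolded invertible_def]] by (simp add: matrix_inv_def)
qed

lemma J3_tendsto:
  assumes "a > 0"
  shows "((\<lambda>(\<sigma>0, \<sigma>1, \<sigma>2). J3 a \<sigma>0 \<sigma>1 \<sigma>2) \<longlongrightarrow> J30 a)
           (at (0, 0, 0) within (UNIV - {0, - 1}) \<times> (UNIV - {0, - 1}) \<times> (UNIV - {0, - 1}))"
    (is "(?f \<longlongrightarrow> _) ?F")
proof -
  \<comment> \<open>The closed form has no singularity at the origin, so its limit can be taken
    entry by entry.\<close>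
  let ?J = "\<lambda>x. block_mat (vector
     [vector [0, Kmat a (fst (snd x)), 0, 0],
      vector [Kmat a (fst x), 0, Lmat a (fst x), 0],
      vector [0, Lmat a (fst x), 0, Kmat a (fst x)],
      vector [0, 0, Kmat a (snd (snd x)), 0]])"
  have id: "((\<lambda>x. x) \<longlongrightarrow> (0, 0, 0)) ?F"
    by (rule tendsto_ident_at)
  have coord: "(fst \<longlongrightarrow> 0) ?F" "((\<lambda>x. fst (snd x)) \<longlongrightarrow> 0) ?F" "((\<lambda>x. snd (snd x)) \<longlongrightarrow> 0) ?F"
    using tendsto_fst[OF id] tendsto_fst[OF tendsto_snd[OF id]] tendsto_snd[OF tendsto_snd[OF id]]
    by simp_all
  have K: "((\<lambda>x. Kmat a (s x)) \<longlongrightarrow> Pmat a ** Xmat) ?F" if s: "(s \<longlongrightarrow> 0) ?F" for s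
  proof -
    have "((\<lambda>x. s x / (1 + s x)) \<longlongrightarrow> 0 / (1 + 0)) ?F"
      by (intro tendsto_intros s) simp
    then have "((\<lambda>x. Kmat a (s x)) \<longlongrightarrow> cscale (0 / (1 + 0)) ((mat 1 - Pmat a) ** Xmat) + Pmat a ** Xmat) ?F"
      unfolding Kmat_def by (intro tendsto_add tendsto_const tendsto_cscale)
    moreover have "cscale (0 / (1 + 0)) A = 0" for A
      by (simp add: cscale_def vec_eq_iff)
    ultimately show ?thesis
      by simp
  qed
  have L: "((\<lambda>x. Lmat a (s x)) \<longlongrightarrow> twoagR a) ?F" if s: "(s \<longlongrightarrow> 0) ?F" for s
  proof -
    have "((\<lambda>x. 1 / (1 + s x)) \<longlongrightarrow> 1 / (1 + 0)) ?F"
      by (intro tendsto_intros s) simp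
    then have "((\<lambda>x. Lmat a (s x)) \<longlongrightarrow> cscale (1 / (1 + 0)) (twoagR a)) ?F"
      unfolding Lmat_def by (rule tendsto_cscale)
    moreover have "cscale (1 / (1 + 0)) A = A" for A
      by (simp add: cscale_def vec_eq_iff)
    ultimately show ?thesis
      by simp
  qed
  have "(?J \<longlongrightarrow> J30 a) ?F"
    unfolding J30_def
  proof (rule tendsto_block_mat)
    fix i j :: 4
    show "((\<lambda>x. vector
     [vector [0, Kmat a (fst (snd x)), 0, 0],
      vector [Kmat a (fst x), 0, Lmat a (fst x), 0],
      vector [0, Lmat a (fst x), 0, Kmat a (fst x)],
      vector [0, 0, Kmat a (snd (snd x)), 0]] $ i $ j) \<longlongrightarrow>
      vector
     [vector [0, Pmat a ** Xmat, 0, 0],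
      vector [Pmat a ** Xmat, 0, twoagR a, 0],
      vector [0, twoagR a, 0, Pmat a ** Xmat],
      vector [0, 0, Pmat a ** Xmat, 0]] $ i $ j) ?F"
      using exhaust_4[of i] exhaust_4[of j]
      by (elim disjE) (simp_all add: vector_4 K L coord)
  qed
  \<comment> \<open>The filter sees only admissible triples, and on all of these the closed form
    equals \<open>J3\<close>.\<close>
  moreover have "\<forall>\<^sub>F x in ?F. ?J x = ?f x"
    unfolding eventually_at_filter
    by (rule always_eventually) (auto simp: J3_eq assms)
  ultimately show ?thesis
    by (rule Lim_transform_eventually)
qed

lemma J30_power4:
  assumes "a > 0"
  shows "J30 a ** J30 a ** J30 a ** J30 a = 0"
proof -
  let ?A = "Pmat a ** Xmat" and ?B = "twoagR a"
  let ?S = "vector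
     [vector [0, 0, ?A ** ?B, 0],
      vector [0, 0, 0, ?B ** ?A],
      vector [?B ** ?A, 0, 0, 0],
      vector [0, ?A ** ?B, 0, 0]] :: complex^2^2^4^4"
  have S: "J30 a ** J30 a = block_mat ?S"
    unfolding J30_def block_mat_mult
    by (rule arg_cong[where f = block_mat]; subst vec_eq_iff; subst vec_eq_iff)
       (simp add: forall_4 sum_4 vector_4 PX_square[OF assms] twoagR_square[OF assms])
  \<comment> \<open>Block products in the square of \<open>?S\<close> are
    \<open>(?A ** ?B) ** (?B ** ?A)\<close> or the same with \<open>?A\<close> and \<open>?B\<close>
    exchanged: a square always stands in the middle.\<close>
  have "(X ** Y) ** (Y ** Z) = 0" if "Y ** Y = 0" for X Y Z :: "complex^2^2"
  proof -
    have "(X ** Y) ** (Y ** Z) = X ** (Y ** Y) ** Z"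
      by (simp add: matrix_mul_assoc)
    with that show ?thesis
      by simp
  qed
  then have "block_mat ?S ** block_mat ?S = block_mat 0"
    unfolding block_mat_mult
    by (intro arg_cong[where f = block_mat]; subst vec_eq_iff; subst vec_eq_iff)
       (simp add: forall_4 sum_4 vector_4 PX_square[OF assms] twoagR_square[OF assms])
  also have "block_mat 0 = 0"
    by (simp add: block_mat_def vec_eq_iff)
  finally show ?thesis
    by (simp add: S flip: matrix_mul_assoc)
qed

theorem mainTheorem4:
  fixes a :: real
  assumes "a > 0"
  shows "((\<lambda>(\<sigma>0, \<sigma>1, \<sigma>2). J3 a \<sigma>0 \<sigma>1 \<sigma>2) \<longlongrightarrow> J30 a)
           (at (0, 0, 0) within (UNIV - {0, - 1}) \<times> (UNIV - {0, - 1}) \<times> (UNIV - {0, - 1}))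
       \<and> J30 a ** J30 a ** J30 a ** J30 a = 0
       \<and> (\<forall>\<alpha>m \<beta>m \<alpha>p \<beta>p :: complex.
            \<exists>V. (\<forall>W. W = J30 a *v W + Ftilde a \<alpha>m \<beta>m \<alpha>p \<beta>p \<longleftrightarrow> W = V)
              \<and> (\<forall>U :: nat \<Rightarrow> complex^(4 \<times> 2).
                   (\<forall>n. U (Suc n) = J30 a *v U n + Ftilde a \<alpha>m \<beta>m \<alpha>p \<beta>p)
                   \<longrightarrow> (\<forall>n\<ge>4. U n = V)))"
proof -
  \<comment> \<open>Four applications of \<open>J30 a\<close> amount to one of its fourth
    power.\<close>
  have "((*v) (J30 a) ^^ 4) x = 0" for x
    using J30_power4[OF assms]
    by (simp add: numeral_eq_Suc matrix_vector_mul_assoc matrix_mul_assoc)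
  then show ?thesis
    using J3_tendsto[OF assms] J30_power4[OF assms]
      affine_iteration_nilpotent[of "(*v) (J30 a)" 4, OF matrix_vector_mult_diff_distrib]
    by blast
qed

end
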